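(* Let $N$ and $X$ be finite sets with $n=|N|$. The maps $$\mathcal F\colon\mathcal B(N,X)\to\mathrm{Fam}_n(X),\qquad \mathcal F(R)=(R(i))_{i\in N},\quad R(i):=\{a\in X:(i,a)\in R\},$$ and $$\Phi\colon\mathrm{Fam}_n(X)\to\mathrm{Hom}(\mathcal P(N),\mathcal P(X)),\qquad \Phi(F)(I)=\bigcup_{i\in I}F_i\quad(I\subseteq N),$$ are bijections. The inverse of $\mathcal F$ is $\mathcal R(F)=\{(i,a)\in N\times X: a\in F_i\}$, and the inverse of $\Phi$ is $\Psi(\phi)=(\phi(\{i\}))_{i\in N}$.
   Context: $\mathcal P(N)$ is the power set of $N$. $\mathcal B(N,X)$ is the set of all binary relations $R\subseteq N\times X$. $\mathrm{Fam}_n(X)$ is the set of all $n$-families of subsets of $X$, i.e. tuples $F=(F_i)_{i\in N}$ with each $F_i\subseteq X$. $\mathrm{Hom}(\mathcal P(N),\mathcal P(X))$ is the set of all functions $\phi\colon\mathcal P(N)\to\mathcal P(X)$ satisfying $\phi(I\cup J)=\phi(I)\cup\phi(J)$ for all $I,J\subseteq N$ and $\phi(\varnothing)=\varnothing$. *)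

theory Defs
  imports Main "HOL-Library.FuncSet"
begin

text \<open>
  Functions with a restricted domain (families indexed by \<open>N\<close>, maps on \<open>Pow N\<close>) are elements of
  the extensional function spaces of \<open>HOL-Library.FuncSet\<close>, that is, they are \<open>undefined\<close> outside
  their domain. Equality of HOL functions then is equality of families or maps.
\<close>

definition bin_rels :: "'i set \<Rightarrow> 'a set \<Rightarrow> ('i \<times> 'a) set set" where
  "bin_rels N X = Pow (N \<times> X)"

text \<open>An \<open>n\<close>-family is a tuple indexed by the set \<open>N\<close> itself, where \<open>n = card N\<close>.\<close>

definition families :: "'i set \<Rightarrow> 'a set \<Rightarrow> ('i \<Rightarrow> 'a set) set" where
  "families N X = (N \<rightarrow>\<^sub>E Pow X)"

definition join_homs :: "'i set \<Rightarrow> 'a set \<Rightarrow> ('i set \<Rightarrow> 'a set) set" where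
  "join_homs N X = {\<phi> \<in> Pow N \<rightarrow>\<^sub>E Pow X.
     (\<forall>I J. I \<subseteq> N \<longrightarrow> J \<subseteq> N \<longrightarrow> \<phi> (I \<union> J) = \<phi> I \<union> \<phi> J) \<and> \<phi> {} = {}}"

definition family_of_rel :: "'i set \<Rightarrow> 'a set \<Rightarrow> ('i \<times> 'a) set \<Rightarrow> 'i \<Rightarrow> 'a set" where
  "family_of_rel N X R = (\<lambda>i\<in>N. {a \<in> X. (i, a) \<in> R})"

definition rel_of_family :: "'i set \<Rightarrow> 'a set \<Rightarrow> ('i \<Rightarrow> 'a set) \<Rightarrow> ('i \<times> 'a) set" where
  "rel_of_family N X F = {(i, a) \<in> N \<times> X. a \<in> F i}"

definition hom_of_family :: "'i set \<Rightarrow> ('i \<Rightarrow> 'a set) \<Rightarrow> 'i set \<Rightarrow> 'a set" where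
  "hom_of_family N F = (\<lambda>I\<in>Pow N. \<Union>i\<in>I. F i)"

definition family_of_hom :: "'i set \<Rightarrow> ('i set \<Rightarrow> 'a set) \<Rightarrow> 'i \<Rightarrow> 'a set" where
  "family_of_hom N \<phi> = (\<lambda>i\<in>N. \<phi> {i})"

text \<open>\<open>g\<close> is the inverse of the map \<open>f\<close> from \<open>A\<close> to \<open>B\<close>, both regarded as maps between these sets.\<close>

definition is_inverse :: "'a set \<Rightarrow> 'b set \<Rightarrow> ('a \<Rightarrow> 'b) \<Rightarrow> ('b \<Rightarrow> 'a) \<Rightarrow> bool" where
  "is_inverse A B f g \<longleftrightarrow>
     f \<in> A \<rightarrow> B \<and> g \<in> B \<rightarrow> A \<and> (\<forall>x\<in>A. g (f x) = x) \<and> (\<forall>y\<in>B. f (g y) = y)"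

end

theory Submission
  imports Defs
begin

text \<open>
  Both bijections follow from exhibiting two-sided inverses. A relation and its family of rows carry
  the same data, so the first pair is inverse to each other by comparing elements. A family is
  recovered from the union map because the union over \<open>{i}\<close> is \<open>F i\<close>. Finiteness of
  \<open>N\<close> enters where a join homomorphism is recovered from its values on singletons
  (\<open>join_hom_eq_Union_singletons\<close>): a finite set is a finite join of singletons, whereas preserving
  binary joins and \<open>\<emptyset>\<close> does not imply preserving infinite joins.
\<close>

lemma bij_betw_if_is_inverse:
  assumes "is_inverse A B f g"
  shows "bij_betw f A B"
  using assms unfolding is_inverse_def by (auto intro: bij_betw_byWitness[where f' = g])

lemma is_inverse_family_of_rel:
  "is_inverse (bin_rels N X) (families N X) (family_of_rel N X) (rel_of_family N X)"
  unfolding is_inverse_def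
proof (intro conjI ballI)
  show "family_of_rel N X \<in> bin_rels N X \<rightarrow> families N X"
    by (auto simp: families_def family_of_rel_def)
  show "rel_of_family N X \<in> families N X \<rightarrow> bin_rels N X"
    by (auto simp: bin_rels_def rel_of_family_def)
  show "rel_of_family N X (family_of_rel N X R) = R" if "R \<in> bin_rels N X" for R
    using that by (auto simp: bin_rels_def rel_of_family_def family_of_rel_def)
  show "family_of_rel N X (rel_of_family N X F) = F" if "F \<in> families N X" for F
  proof (rule extensionalityI[of _ N])
    show "family_of_rel N X (rel_of_family N X F) i = F i" if "i \<in> N" for i
      using \<open>F \<in> families N X\<close> that
      by (auto simp: families_def rel_of_family_def family_of_rel_def PiE_iff)
  qed (use that in \<open>auto simp: families_def family_of_rel_def PiE_iff\<close>)
qed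

text \<open>
  Adding the elements of \<open>I\<close> one at a time uses preservation of \<open>\<emptyset>\<close> at the start and of a binary
  join with a singleton at each step.
\<close>
lemma join_hom_eq_Union_singletons:
  assumes "\<phi> \<in> join_homs N X" and "finite I" and "I \<subseteq> N"
  shows "\<phi> I = (\<Union>i\<in>I. \<phi> {i})"
  using assms(2,3)
proof (induction I rule: finite_induct)
  case empty
  show ?case using assms(1) by (simp add: join_homs_def)
next
  case (insert i I)
  have join: "\<phi> (A \<union> B) = \<phi> A \<union> \<phi> B" if "A \<subseteq> N" "B \<subseteq> N" for A B
    using assms(1) that by (simp add: join_homs_def)
  have "\<phi> ({i} \<union> I) = \<phi> {i} \<union> \<phi> I"
    using insert.prems by (intro join) auto
  then show ?case using insert by simp
qed

lemma hom_of_family_in_join_homs: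
  assumes "F \<in> families N X"
  shows "hom_of_family N F \<in> join_homs N X"
proof -
  have "hom_of_family N F \<in> Pow N \<rightarrow>\<^sub>E Pow X"
    using assms by (auto simp: families_def hom_of_family_def PiE_iff)
  then show ?thesis
    by (auto simp: join_homs_def hom_of_family_def)
qed

lemma is_inverse_hom_of_family:
  assumes "finite N"
  shows "is_inverse (families N X) (join_homs N X) (hom_of_family N) (family_of_hom N)"
  unfolding is_inverse_def
proof (intro conjI ballI)
  show "hom_of_family N \<in> families N X \<rightarrow> join_homs N X"
    by (simp add: hom_of_family_in_join_homs)
  show "family_of_hom N \<in> join_homs N X \<rightarrow> families N X"
    by (auto simp: families_def join_homs_def family_of_hom_def PiE_iff)
  show "family_of_hom N (hom_of_family N F) = F" if "F \<in> families N X" for F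
    using that
    by (intro extensionalityI[of _ N])
      (auto simp: families_def family_of_hom_def hom_of_family_def PiE_iff)
  show "hom_of_family N (family_of_hom N \<phi>) = \<phi>" if "\<phi> \<in> join_homs N X" for \<phi>
  proof (rule extensionalityI[of _ "Pow N"])
    show "hom_of_family N (family_of_hom N \<phi>) I = \<phi> I" if "I \<in> Pow N" for I
    proof -
      have "I \<subseteq> N" using that by simp
      then have "(\<Union>i\<in>I. family_of_hom N \<phi> i) = (\<Union>i\<in>I. \<phi> {i})"
        by (intro SUP_cong) (auto simp: family_of_hom_def)
      also have "\<dots> = \<phi> I"
        using join_hom_eq_Union_singletons[OF \<open>\<phi> \<in> join_homs N X\<close> _ \<open>I \<subseteq> N\<close>]
          finite_subset[OF \<open>I \<subseteq> N\<close> assms] by simp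
      finally show ?thesis using that by (simp add: hom_of_family_def)
    qed
  qed (use that in \<open>auto simp: join_homs_def hom_of_family_def PiE_iff\<close>)
qed

theorem theorem6p5:
  fixes N :: "'i set" and X :: "'a set" and n :: nat
  assumes "finite N" and "finite X" and "n = card N"
  shows "bij_betw (family_of_rel N X) (bin_rels N X) (families N X)
    \<and> bij_betw (hom_of_family N) (families N X) (join_homs N X)
    \<and> is_inverse (bin_rels N X) (families N X) (family_of_rel N X) (rel_of_family N X)
    \<and> is_inverse (families N X) (join_homs N X) (hom_of_family N) (family_of_hom N)"
proof -
  note rel = is_inverse_family_of_rel[of N X]
  note hom = is_inverse_hom_of_family[OF \<open>finite N\<close>, of X]
  show ?thesis
    using bij_betw_if_is_inverse[OF rel] bij_betw_if_is_inverse[OF hom] rel hom by simp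
qed

end
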